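(* Let $m\ge3$ be odd and $n\ge2$. Then the set $\mathbb{H}_2=\{\mathcal{A}\in\mathbb{S}_{m,n} : \mathcal{A}-N(\mathcal{A})\in\mathbb{COP}_{m,n}\}$ is convex and satisfies $\mathbb{N}^+_{m,n}\subseteq\mathbb{H}_2\subseteq\mathbb{COP}_{m,n}$.
   Context: $\mathbb{S}_{m,n}$ is the set of real symmetric tensors of order $m$ and dimension $n$. For $\mathcal{A}=(a_{i_1\cdots i_m})\in\mathbb{S}_{m,n}$, $N(\mathcal{A})$ is the tensor with $N(\mathcal{A})_{i_1\cdots i_m}=a_{i_1\cdots i_m}$ if $a_{i_1\cdots i_m}>0$ and not all of $i_1,\dots,i_m$ are equal, and $N(\mathcal{A})_{i_1\cdots i_m}=0$ otherwise. $\mathbb{COP}_{m,n}$ is the set of copositive tensors in $\mathbb{S}_{m,n}$, i.e. those with $\mathcal{A}\mathbf{x}^m=\sum a_{i_1\cdots i_m}x_{i_1}\cdots x_{i_m}\ge0$ for all $\mathbf{x}\in\mathbb{R}^n_+$. $\mathbb{N}^+_{m,n}$ is the set of entrywise nonnegative tensors in $\mathbb{S}_{m,n}$. *)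

theory Defs
  imports "HOL-Analysis.Analysis"
begin

text \<open>
  The order m and the dimension n of a tensor are the cardinalities of two finite index types:
  a multi-index \<open>(i_1, ..., i_m)\<close> is a function from the m positions to the n coordinates, so that
  a tensor is an element of the real vector space of dimension \<open>n ^ m\<close>.
\<close>

type_synonym ('m, 'n) tensor = "real ^ ('m \<Rightarrow> 'n)"

definition sym_tensors :: "('m::finite, 'n::finite) tensor set" where
  "sym_tensors = {A. \<forall>p i. bij p \<longrightarrow> A $ (i \<circ> p) = A $ i}"

definition tensor_form :: "('m::finite, 'n::finite) tensor \<Rightarrow> real ^ 'n \<Rightarrow> real" where
  "tensor_form A x = (\<Sum>i\<in>UNIV. A $ i * (\<Prod>k\<in>UNIV. x $ i k))"

definition copositive_tensors :: "('m::finite, 'n::finite) tensor set" where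
  "copositive_tensors = {A \<in> sym_tensors. \<forall>x. (\<forall>j. 0 \<le> x $ j) \<longrightarrow> 0 \<le> tensor_form A x}"

definition nonneg_tensors :: "('m::finite, 'n::finite) tensor set" where
  "nonneg_tensors = {A \<in> sym_tensors. \<forall>i. 0 \<le> A $ i}"

definition pos_offdiag :: "('m::finite, 'n::finite) tensor \<Rightarrow> ('m, 'n) tensor" where
  "pos_offdiag A = (\<chi> i. if 0 < A $ i \<and> \<not> (\<forall>k l. i k = i l) then A $ i else 0)"

definition H2 :: "('m::finite, 'n::finite) tensor set" where
  "H2 = {A \<in> sym_tensors. A - pos_offdiag A \<in> copositive_tensors}"

end

theory Submission
  imports Defs
begin

text \<open>
  Each entry of \<open>A - N(A)\<close> is a concave, positively homogeneous function of the same entry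
  of \<open>A\<close>: the identity on the diagonal and \<open>min a 0\<close> elsewhere. Since \<open>A x^m\<close> is monotone in the
  entries of \<open>A\<close> for nonnegative \<open>x\<close>, copositivity of \<open>A - N(A)\<close> is preserved by conic
  combinations.
\<close>

lemma tensor_form_mono:
  assumes "\<And>i. A $ i \<le> B $ i" and "\<And>j. 0 \<le> x $ j"
  shows "tensor_form A x \<le> tensor_form B x"
  unfolding tensor_form_def
  by (intro sum_mono mult_right_mono prod_nonneg) (use assms in auto)

lemma tensor_form_add: "tensor_form (A + B) x = tensor_form A x + tensor_form B x"
  by (simp add: tensor_form_def distrib_right sum.distrib)

lemma tensor_form_scaleR: "tensor_form (c *\<^sub>R A) x = c * tensor_form A x"
  by (simp add: tensor_form_def sum_distrib_left mult.assoc)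

lemma subspace_sym_tensors: "subspace sym_tensors"
  by (simp add: subspace_def sym_tensors_def)

text \<open>Used twice below: to pass from a combination of truncated tensors to the truncation of
  the combination, and from \<open>A - pos_offdiag A\<close> back to \<open>A\<close>.\<close>

lemma copositive_tensors_mono:
  assumes "A \<in> copositive_tensors" and "B \<in> sym_tensors" and "\<And>i. A $ i \<le> B $ i"
  shows "B \<in> copositive_tensors"
proof -
  have "0 \<le> tensor_form B x" if "\<And>j. 0 \<le> x $ j" for x
  proof -
    have "0 \<le> tensor_form A x"
      using assms(1) that by (simp add: copositive_tensors_def)
    also have "\<dots> \<le> tensor_form B x"
      using assms(3) that by (rule tensor_form_mono)
    finally show ?thesis .
  qed
  with assms(2) show ?thesis
    by (simp add: copositive_tensors_def)
qed

text \<open>For fixed \<open>x\<close> the form is linear in the tensor, so each copositivity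
  condition cuts out a half-space.\<close>

lemma convex_copositive_tensors: "convex copositive_tensors"
  unfolding convex_def copositive_tensors_def
  by (auto simp: tensor_form_add tensor_form_scaleR
      intro!: subspace_add[OF subspace_sym_tensors] subspace_scale[OF subspace_sym_tensors])

lemma nonneg_tensors_subset_copositive_tensors: "nonneg_tensors \<subseteq> copositive_tensors"
  by (auto simp: nonneg_tensors_def copositive_tensors_def tensor_form_def
      intro!: sum_nonneg mult_nonneg_nonneg prod_nonneg)

text \<open>Permuting the positions preserves both tests in \<open>pos_offdiag\<close>: the sign of
  the entry, by symmetry of \<open>A\<close>, and whether the multi-index is constant, because
  \<open>p\<close> is surjective.\<close>

lemma pos_offdiag_sym:
  assumes "A \<in> sym_tensors"
  shows "pos_offdiag A \<in> sym_tensors"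
proof -
  have "(\<forall>k l. i (p k) = i (p l)) \<longleftrightarrow> (\<forall>k l. i k = i l)"
    if "bij p" for p :: "'a \<Rightarrow> 'a" and i :: "'a \<Rightarrow> 'b"
    using bij_is_surj[OF that] by (metis surjD)
  moreover have "A $ (i \<circ> p) = A $ i" if "bij p" for p i
    using assms that by (simp add: sym_tensors_def)
  ultimately show ?thesis
    by (auto simp: sym_tensors_def pos_offdiag_def)
qed

lemma diff_pos_offdiag_sym: "A \<in> sym_tensors \<Longrightarrow> A - pos_offdiag A \<in> sym_tensors"
  by (intro subspace_diff[OF subspace_sym_tensors] pos_offdiag_sym)

lemma diff_pos_offdiag_nth:
  "(A - pos_offdiag A) $ i = (if \<forall>k l. i k = i l then A $ i else min (A $ i) 0)"
  by (auto simp: pos_offdiag_def min_def)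

lemma diff_pos_offdiag_concave:
  assumes "0 \<le> u" and "0 \<le> v"
  shows "(u *\<^sub>R (A - pos_offdiag A) + v *\<^sub>R (B - pos_offdiag B)) $ i
    \<le> ((u *\<^sub>R A + v *\<^sub>R B) - pos_offdiag (u *\<^sub>R A + v *\<^sub>R B)) $ i"
proof -
  \<comment> \<open>This is the off-diagonal case: the left side is bounded both by
    \<open>u * a + v * b\<close> and by 0. On the diagonal the two sides agree.\<close>
  have "u * min a 0 + v * min b 0 \<le> min (u * a + v * b) 0" for a b :: real
    using assms by (intro min.boundedI add_mono mult_left_mono add_nonpos_nonpos mult_nonneg_nonpos) auto
  then show ?thesis
    unfolding diff_pos_offdiag_nth vector_add_component vector_scaleR_component by simp
qed

lemma convex_H2: "convex H2"
proof (rule convexI)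
  fix A B :: "('m::finite, 'n::finite) tensor" and u v :: real
  assume "A \<in> H2" "B \<in> H2" and uv: "0 \<le> u" "0 \<le> v" "u + v = 1"
  then have sym: "u *\<^sub>R A + v *\<^sub>R B \<in> sym_tensors"
    and "u *\<^sub>R (A - pos_offdiag A) + v *\<^sub>R (B - pos_offdiag B) \<in> copositive_tensors"
    by (auto simp: H2_def intro!: convexD[OF convex_copositive_tensors]
        subspace_add[OF subspace_sym_tensors] subspace_scale[OF subspace_sym_tensors])
  then show "u *\<^sub>R A + v *\<^sub>R B \<in> H2"
    unfolding H2_def
    \<comment> \<open>The copositive combination of the two truncations lies entrywise below the
      truncation of \<open>u *\<^sub>R A + v *\<^sub>R B\<close>, which is therefore
      copositive.\<close>
    using copositive_tensors_mono[OF _ diff_pos_offdiag_sym[OF sym] diff_pos_offdiag_concave[OF uv(1,2)]]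
    by blast
qed

text \<open>For nonnegative \<open>A\<close>, subtracting \<open>pos_offdiag A\<close> leaves just
  the diagonal of \<open>A\<close>, which is again nonnegative.\<close>

lemma nonneg_tensors_subset_H2: "nonneg_tensors \<subseteq> H2"
proof
  fix A :: "('m::finite, 'n::finite) tensor"
  assume A: "A \<in> nonneg_tensors"
  then have "A - pos_offdiag A \<in> nonneg_tensors"
    unfolding nonneg_tensors_def mem_Collect_eq diff_pos_offdiag_nth
    by (auto intro: diff_pos_offdiag_sym)
  with A show "A \<in> H2"
    using nonneg_tensors_subset_copositive_tensors by (auto simp: H2_def nonneg_tensors_def)
qed

lemma H2_subset_copositive_tensors: "H2 \<subseteq> copositive_tensors"
proof
  fix A :: "('m::finite, 'n::finite) tensor"
  assume "A \<in> H2"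
  then have "A \<in> sym_tensors" and "A - pos_offdiag A \<in> copositive_tensors"
    by (simp_all add: H2_def)
  \<comment> \<open>Only positive entries are removed, so \<open>A\<close> dominates the
    difference.\<close>
  moreover have "(A - pos_offdiag A) $ i \<le> A $ i" for i
    by (simp add: pos_offdiag_def)
  ultimately show "A \<in> copositive_tensors"
    by (blast intro: copositive_tensors_mono)
qed

theorem theorem4p2:
  assumes "CARD('m::finite) \<ge> 3" and "odd CARD('m)" and "CARD('n::finite) \<ge> 2"
  shows "convex (H2 :: ('m, 'n) tensor set) \<and>
    (nonneg_tensors :: ('m, 'n) tensor set) \<subseteq> H2 \<and>
    (H2 :: ('m, 'n) tensor set) \<subseteq> copositive_tensors"
  using convex_H2 nonneg_tensors_subset_H2 H2_subset_copositive_tensors by blast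

end
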